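(* Let $A,B,\Omega\in\mathbb{R}^{n\times n}$ and $b\in\mathbb{R}^n$ be such that the generalized absolute value equation $Ax-B|x|=b$ has a unique solution $x^{\ast}\in\mathbb{R}^n$. Let $A+B+\Omega$ be invertible, and define $$f_{\Omega}=|(A+B+\Omega)^{-1}\Omega|,\qquad g_{\Omega}=2|(A+B+\Omega)^{-1}B|.$$ If $\rho(f_{\Omega}+g_{\Omega})<1$, then the maximum-based iteration method $$x^{k+1}=(A+B+\Omega)^{-1}\bigl(\Omega x^{k}+2B\max\{0,x^{k}\}+b\bigr),\quad k=0,1,2,\ldots,$$ is convergent, i.e., for every initial vector $x^{0}\in\mathbb{R}^n$ the sequence $\{x^k\}$ converges to $x^{\ast}$.
   Context: For a vector or matrix $X$ with real entries, $|X|$ denotes the entrywise absolute value. For $x\in\mathbb{R}^n$, $\max\{0,x\}$ is the entrywise maximum of $x$ and the zero vector. $\rho(\cdot)$ denotes the spectral radius. *)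

theory Defs
  imports "HOL-Analysis.Analysis"
begin

text \<open>
  The lattice operations on \<^typ>\<open>real ^ 'n\<close> and \<^typ>\<open>real ^ 'n ^ 'n\<close> are the componentwise ones of
  class \<^class>\<open>ordered_euclidean_space\<close>: \<open>\<bar>X\<bar>\<close> is the entrywise absolute value of a vector or a
  matrix, and \<^term>\<open>sup 0 x\<close> is the entrywise maximum of \<open>x\<close> and the zero vector.  (\<^const>\<open>max\<close> would
  be wrong, since the order on vectors is only partial.)
\<close>

lemma abs_vec_entry: "\<bar>x :: real ^ 'n\<bar> $ i = \<bar>x $ i\<bar>"
  by (simp add: abs_vec_def)

lemma abs_matrix_entry: "\<bar>M :: real ^ 'n ^ 'm\<bar> $ i $ j = \<bar>M $ i $ j\<bar>"
  by (simp add: abs_vec_def)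

lemma sup_zero_vec_entry: "sup 0 (x :: real ^ 'n) $ i = max 0 (x $ i)"
  by (simp add: sup_vec_def sup_max)

definition mat_spectrum :: "complex ^ 'n ^ 'n \<Rightarrow> complex set" where
  "mat_spectrum M = {c. \<exists>v. v \<noteq> 0 \<and> M *v v = c *s v}"

text \<open>The eigenvalues of a real matrix are taken over the complex numbers.\<close>

definition mat_spectral_radius :: "real ^ 'n ^ 'n \<Rightarrow> real" where
  "mat_spectral_radius M = Max (norm ` mat_spectrum (map_matrix complex_of_real M))"

definition gave_solution ::
    "real ^ 'n ^ 'n \<Rightarrow> real ^ 'n ^ 'n \<Rightarrow> real ^ 'n \<Rightarrow> real ^ 'n \<Rightarrow> bool" where
  "gave_solution A B b x \<longleftrightarrow> A *v x - B *v \<bar>x\<bar> = b"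

definition f_mat :: "real ^ 'n ^ 'n \<Rightarrow> real ^ 'n ^ 'n \<Rightarrow> real ^ 'n ^ 'n \<Rightarrow> real ^ 'n ^ 'n" where
  "f_mat A B \<Omega> = \<bar>matrix_inv (A + B + \<Omega>) ** \<Omega>\<bar>"

definition g_mat :: "real ^ 'n ^ 'n \<Rightarrow> real ^ 'n ^ 'n \<Rightarrow> real ^ 'n ^ 'n \<Rightarrow> real ^ 'n ^ 'n" where
  "g_mat A B \<Omega> = 2 *\<^sub>R \<bar>matrix_inv (A + B + \<Omega>) ** B\<bar>"

primrec max_iter ::
    "real ^ 'n ^ 'n \<Rightarrow> real ^ 'n ^ 'n \<Rightarrow> real ^ 'n ^ 'n \<Rightarrow> real ^ 'n \<Rightarrow> real ^ 'n \<Rightarrow> nat \<Rightarrow> real ^ 'n"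
where
  "max_iter A B \<Omega> b x0 0 = x0"
| "max_iter A B \<Omega> b x0 (Suc k) =
     matrix_inv (A + B + \<Omega>) *v
       (\<Omega> *v max_iter A B \<Omega> b x0 k + 2 *\<^sub>R (B *v sup 0 (max_iter A B \<Omega> b x0 k)) + b)"

end

theory Submission
  imports Defs
begin

text \<open>
  Let \<open>T = f_mat + g_mat\<close>.  Since a solution is a fixed point of the iteration and
  \<open>x \<mapsto> sup 0 x\<close> is entrywise nonexpansive, the errors satisfy \<open>\<bar>e (Suc k)\<bar> \<le> T *v \<bar>e k\<bar>\<close>.
  To see that they vanish, follow the solution \<open>v t\<close> of \<open>v = 1 + t T v\<close> (with \<open>1\<close> the all-ones vector)
  from \<open>t = 0\<close> to \<open>t = 1\<close>.  It exists because \<open>T\<close> has no real eigenvalue \<open>\<ge> 1\<close>, is continuous in \<open>t\<close>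
  by Cramer's rule, and is \<open>\<ge> 1\<close> as soon as it is \<open>\<ge> 0\<close>; hence the set of \<open>t\<close> with \<open>v t \<ge> 0\<close> is
  clopen in \<open>[0, 1]\<close>.  So \<open>v 1 \<ge> 1\<close> and \<open>T (v 1) = v 1 - 1 \<le> r v 1\<close> with \<open>r < 1\<close>, which makes the errors
  decay geometrically in the maximum norm weighted by \<open>v 1\<close>.
\<close>

section \<open>Eigenvalues and the spectral radius\<close>

text \<open>Applying \<open>M - d I\<close> to a vanishing combination removes the term of
  \<open>d\<close> and multiplies every other coefficient by the nonzero factor
  \<open>c - d\<close>, which reduces the claim to a smaller set of eigenvalues.\<close>

lemma eigenvectors_scalars_zero:
  fixes M :: "'a::field ^ 'n ^ 'n"
  assumes "finite C" and "\<And>c. c \<in> C \<Longrightarrow> w c \<noteq> 0 \<and> M *v w c = c *s w c"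
    and "(\<Sum>c\<in>C. u c *s w c) = 0" and "c \<in> C"
  shows "u c = 0"
  using assms
proof (induction C arbitrary: u c)
  case empty
  then show ?case by simp
next
  case (insert d C)
  have eq: "u d *s w d + (\<Sum>c\<in>C. u c *s w c) = 0"
    using insert by simp
  have "M *v (u d *s w d + (\<Sum>c\<in>C. u c *s w c)) = d *s (u d *s w d) + (\<Sum>c\<in>C. u c *s (c *s w c))"
    using insert.prems(1)
    by (simp add: matrix_vector_right_distrib vec.linear_sum[OF matrix_vector_mul_linear_gen] vec.scale
        vec.scale_left_commute)
  moreover have "d *s (u d *s w d + (\<Sum>c\<in>C. u c *s w c)) = d *s (u d *s w d) + (\<Sum>c\<in>C. d *s (u c *s w c))"
    by (simp add: vec.scale_right_distrib vec.scale_sum_right)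
  ultimately have "(\<Sum>c\<in>C. u c *s (c *s w c)) - (\<Sum>c\<in>C. d *s (u c *s w c)) = 0"
    unfolding eq matrix_vector_mult_0_right vec.scale_zero_right right_minus_eq
    by (rule add_left_imp_eq[OF trans[OF sym]])
  moreover have "(\<Sum>c\<in>C. (u c * (c - d)) *s w c) = (\<Sum>c\<in>C. u c *s (c *s w c)) - (\<Sum>c\<in>C. d *s (u c *s w c))"
    by (simp add: algebra_simps vec.scale_left_diff_distrib sum_subtractf)
  ultimately have "u e * (e - d) = 0" if "e \<in> C" for e
    using insert.IH[of "\<lambda>c. u c * (c - d)"] insert.prems(1) that by auto
  then have zero: "u e = 0" if "e \<in> C" for e
    using that insert.hyps by force
  then have "u d *s w d = 0"
    using eq by simp
  then show ?case
    using zero insert.prems by auto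
qed

text \<open>Without finiteness, the \<^const>\<open>Max\<close> in \<^const>\<open>mat_spectral_radius\<close> would bound nothing.\<close>

lemma finite_mat_spectrum: "finite (mat_spectrum (M :: complex ^ 'n ^ 'n))"
proof -
  define w where "w c = (SOME v. v \<noteq> 0 \<and> M *v v = c *s v)" for c
  have w: "w c \<noteq> 0 \<and> M *v w c = c *s w c" if "c \<in> mat_spectrum M" for c
    unfolding w_def by (rule someI_ex) (use that in \<open>simp add: mat_spectrum_def\<close>)
  \<comment> \<open>Independence of eigenvectors to distinct eigenvalues bounds all finite subsets
    of the spectrum by the dimension; an infinite set would have arbitrarily large ones.\<close>
  have "card C \<le> vec.dim (UNIV :: (complex ^ 'n) set)" if "finite C" "C \<subseteq> mat_spectrum M" for C
  proof -
    have inj: "inj_on w C"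
    proof (rule inj_onI)
      fix c d assume "c \<in> C" "d \<in> C" "w c = w d"
      then have "c *s w c = d *s w c" "w c \<noteq> 0"
        using w that(2) by (metis subsetD)+
      then show "c = d" by simp
    qed
    have "vec.independent (w ` C)"
    proof (rule vec.independent_if_scalars_zero)
      fix f x assume "(\<Sum>x\<in>w ` C. f x *s x) = 0" "x \<in> w ` C"
      then show "f x = 0"
        using eigenvectors_scalars_zero[of C w M "\<lambda>c. f (w c)"] that w inj
        by (auto simp: sum.reindex)
    qed (use that in simp)
    then have "card (w ` C) \<le> vec.dim (w ` C)"
      using vec.dim_eq_card_independent by force
    also have "\<dots> \<le> vec.dim (UNIV :: (complex ^ 'n) set)"
      by (rule vec.dim_subset) simp
    finally show ?thesis using inj by (simp add: card_image)
  qed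
  then show ?thesis
    by (metis infinite_arbitrarily_large lessI linorder_not_less)
qed

text \<open>A real eigenvector, embedded entrywise into the complex vectors, is an eigenvector of
  the complexified matrix.\<close>

lemma real_eigenvalue_le_mat_spectral_radius:
  fixes T :: "real ^ 'n ^ 'n"
  assumes "T *v v = c *\<^sub>R v" and "v \<noteq> 0"
  shows "\<bar>c\<bar> \<le> mat_spectral_radius T"
proof -
  let ?w = "\<chi> i. complex_of_real (v $ i)"
  have "map_matrix complex_of_real T *v ?w = complex_of_real c *s ?w"
    using assms(1)
    by (simp add: vec_eq_iff matrix_vector_mult_def map_matrix_def flip: of_real_mult of_real_sum)
  moreover have "?w \<noteq> 0"
    using assms(2) by (simp add: vec_eq_iff)
  ultimately have "complex_of_real c \<in> mat_spectrum (map_matrix complex_of_real T)"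
    unfolding mat_spectrum_def by blast
  then show ?thesis
    unfolding mat_spectral_radius_def
    by (intro Max_ge) (auto simp: finite_mat_spectrum image_iff intro!: bexI[of _ "complex_of_real c"])
qed

section \<open>Nonnegative matrices and geometric decay\<close>

lemma nonneg_matrix_vector_mono:
  fixes T :: "real ^ 'n ^ 'm"
  assumes "0 \<le> T" and "x \<le> y"
  shows "T *v x \<le> T *v y"
  using assms
  by (auto simp: less_eq_vec_def matrix_vector_mult_def intro!: sum_mono mult_left_mono)

lemma continuous_on_det:
  fixes F :: "'a::topological_space \<Rightarrow> real ^ 'n ^ 'n"
  assumes "\<And>i j. continuous_on S (\<lambda>t. F t $ i $ j)"
  shows "continuous_on S (\<lambda>t. det (F t))"
  unfolding det_def by (intro continuous_intros assms)

lemma positive_resolvent_vector: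
  fixes T :: "real ^ 'n ^ 'n"
  assumes nonneg: "0 \<le> T"
    and eig: "\<And>c v. T *v v = c *\<^sub>R v \<Longrightarrow> v \<noteq> 0 \<Longrightarrow> c < 1"
  obtains v where "vec 1 \<le> v" and "v = vec 1 + T *v v"
proof -
  define A where "A t = mat 1 - t *\<^sub>R T" for t
  define v where
    "v t = (\<chi> k. det (\<chi> i j. if j = k then vec 1 $ i else A t $ i $ j) / det (A t))" for t
  \<comment> \<open>A kernel vector of \<open>A t\<close> would be an eigenvector of
    \<open>T\<close> for \<open>1 / t\<close>, which is at least 1; for \<open>t = 0\<close> the
    matrix is the identity.\<close>
  have det: "det (A t) \<noteq> 0" if "t \<in> {0..1}" for t
  proof
    assume "det (A t) = 0"
    then obtain x where x: "A t *v x = 0" "x \<noteq> 0"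
      using invertible_det_nz[of "A t"]
      by (auto simp: invertible_left_inverse matrix_left_invertible_ker)
    then have tx: "x = t *\<^sub>R (T *v x)"
      by (simp add: A_def matrix_vector_mult_diff_rdistrib flip: scaleR_matrix_vector_assoc)
    then have "t \<noteq> 0"
      using x(2) by auto
    with tx have "T *v x = (1 / t) *\<^sub>R x"
      by (metis scaleR_scaleR divide_inverse left_inverse mult_1 scaleR_one)
    then have "1 / t < 1"
      using eig x(2) by blast
    then show False
      using that \<open>t \<noteq> 0\<close> by (simp add: field_simps)
  qed
  have v: "v t = vec 1 + t *\<^sub>R (T *v v t)" if "t \<in> {0..1}" for t
  proof -
    have "A t *v v t = vec 1"
      using cramer[OF det[OF that], of "v t" "vec 1"] by (simp add: v_def)
    then show ?thesis
      by (simp add: A_def matrix_vector_mult_diff_rdistrib algebra_simps flip: scaleR_matrix_vector_assoc)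
  qed
  have ge1: "vec 1 \<le> v t" if "t \<in> {0..1}" "0 \<le> v t" for t
  proof -
    have "0 \<le> T *v v t"
      using nonneg_matrix_vector_mono[OF nonneg that(2)] by simp
    then have "0 \<le> t *\<^sub>R (T *v v t)"
      using that by (simp add: scaleR_nonneg_nonneg)
    then show ?thesis
      using v[OF that(1)] by (metis le_add_same_cancel1)
  qed
  have contA: "continuous_on {0..1} (\<lambda>t. A t $ i $ j)" for i j
    by (auto simp: A_def intro!: continuous_intros)
  have cont: "continuous_on {0..1} (\<lambda>t. v t $ k)" for k
  proof -
    have "continuous_on {0..1}
      (\<lambda>t. det (\<chi> i j. if j = k then vec 1 $ i else A t $ i $ j) / det (A t))"
    proof (intro continuous_on_divide continuous_on_det contA)
      show "continuous_on {0..1} (\<lambda>t. (\<chi> i j. if j = k then vec 1 $ i else A t $ i $ j) $ i $ j)"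
        for i j by (cases "j = k") (auto intro: contA)
    qed (use det in auto)
    then show ?thesis by (simp add: v_def)
  qed
  define S where "S = {t \<in> {0..1}. 0 \<le> v t}"
  have "S = {0..1} \<inter> (\<Inter>k. {0..1} \<inter> (\<lambda>t. v t $ k) -` {0..})"
    by (auto simp: S_def less_eq_vec_def)
  moreover have "closedin (top_of_set {0..1}) ({0..1} \<inter> (\<Inter>k. {0..1} \<inter> (\<lambda>t. v t $ k) -` {0..}))"
    by (intro closedin_Int closedin_INT continuous_closedin_preimage cont) auto
  \<comment> \<open>By \<open>ge1\<close>, nonnegative entries are already at least 1, so strict
    inequalities define the same set; this makes \<open>S\<close> relatively open.\<close>
  moreover have "S = (\<Inter>k. {0..1} \<inter> (\<lambda>t. v t $ k) -` {0<..})"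
  proof -
    have "0 < v t $ k" if "t \<in> S" for t k
      using ge1[of t] that by (force simp: S_def less_eq_vec_def intro: less_le_trans[of 0 1])
    then show ?thesis
      by (force simp: S_def less_eq_vec_def less_imp_le)
  qed
  moreover have "openin (top_of_set {0..1}) (\<Inter>k. {0..1} \<inter> (\<lambda>t. v t $ k) -` {0<..})"
    by (intro openin_INT2 continuous_openin_preimage_gen cont) auto
  ultimately have "S = {} \<or> S = {0..1}"
    using connected_Icc[of 0 "1::real"] unfolding connected_clopen by metis
  moreover have "0 \<in> S"
    using v[of 0] by (simp add: S_def less_eq_vec_def)
  ultimately have "1 \<in> S"
    by auto
  then show ?thesis
    using that[of "v 1"] ge1[of 1] v[of 1] by (simp add: S_def)
qed

lemma tendsto_zero_if_abs_le_nonneg_matrix: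
  fixes T :: "real ^ 'n ^ 'n" and e :: "nat \<Rightarrow> real ^ 'n"
  assumes nonneg: "0 \<le> T" and rho: "mat_spectral_radius T < 1"
    and step: "\<And>k. \<bar>e (Suc k)\<bar> \<le> T *v \<bar>e k\<bar>"
  shows "e \<longlonglongrightarrow> 0"
proof -
  have "c < 1" if "T *v v = c *\<^sub>R v" "v \<noteq> 0" for c v
    using real_eigenvalue_le_mat_spectral_radius[OF that] rho by linarith
  then obtain v where v1: "vec 1 \<le> v" and v: "v = vec 1 + T *v v"
    using positive_resolvent_vector[OF nonneg] by metis
  have v1': "1 \<le> v $ i" for i
    using v1 by (simp add: less_eq_vec_def)
  define m where "m = Max (range (($) v))"
  have vm: "v $ i \<le> m" for i
    by (simp add: m_def)
  have m1: "1 \<le> m"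
    using v1' vm by (meson order_trans)
  \<comment> \<open>Since \<open>v $ i / m\<close> is at most 1, \<open>v $ i - 1\<close> is at most
    \<open>(1 - 1 / m) * v $ i\<close>.\<close>
  define r where "r = 1 - 1 / m"
  have r: "0 \<le> r" "r < 1"
    using m1 by (auto simp: r_def)
  have Tv: "T *v v \<le> r *\<^sub>R v"
  proof -
    have "(T *v v) $ i \<le> r * v $ i" for i
    proof -
      have "(T *v v) $ i = v $ i - 1"
        using arg_cong[OF v, of "\<lambda>x. x $ i"] by simp
      moreover have "v $ i / m \<le> 1"
        using vm[of i] m1 by simp
      ultimately show ?thesis
        by (simp add: r_def algebra_simps)
    qed
    then show ?thesis by (simp add: less_eq_vec_def)
  qed
  \<comment> \<open>The entries of \<open>v\<close> are at least 1, so \<open>M *\<^sub>R v\<close>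
    dominates the initial error entrywise.\<close>
  define M where "M = norm (e 0)"
  have bound: "\<bar>e k\<bar> \<le> (M * r ^ k) *\<^sub>R v" for k
  proof (induction k)
    case 0
    have "\<bar>e 0 $ i\<bar> \<le> M * v $ i" for i
      using component_le_norm_cart[of "e 0" i] mult_left_mono[OF v1'[of i], of M]
      by (simp add: M_def)
    then show ?case by (simp add: less_eq_vec_def abs_vec_entry)
  next
    case (Suc k)
    have "\<bar>e (Suc k)\<bar> \<le> T *v ((M * r ^ k) *\<^sub>R v)"
      using step nonneg_matrix_vector_mono[OF nonneg Suc] order_trans by blast
    also have "\<dots> = (M * r ^ k) *\<^sub>R (T *v v)"
      by (simp add: matrix_vector_mult_scaleR)
    also have "\<dots> \<le> (M * r ^ k) *\<^sub>R (r *\<^sub>R v)"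
      using r by (intro scaleR_left_mono Tv) (auto simp: M_def)
    finally show ?case by (simp add: algebra_simps)
  qed
  show ?thesis
  proof (rule vec_tendstoI)
    fix i
    have "(\<lambda>k. M * r ^ k * v $ i) \<longlonglongrightarrow> M * 0 * v $ i"
      using r by (intro tendsto_intros LIMSEQ_power_zero) auto
    then have "(\<lambda>k. M * r ^ k * v $ i) \<longlonglongrightarrow> 0"
      by simp
    moreover have "norm (e k $ i) \<le> M * r ^ k * v $ i" for k
      using bound[of k] by (simp add: less_eq_vec_def abs_vec_entry)
    ultimately have "(\<lambda>k. e k $ i) \<longlonglongrightarrow> 0"
      by (metis (no_types, lifting) Lim_null_comparison always_eventually)
    then show "(\<lambda>k. e k $ i) \<longlonglongrightarrow> 0 $ i"
      by simp
  qed
qed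

section \<open>The iteration and its errors\<close>

lemma abs_matrix_vector_le:
  fixes M :: "real ^ 'n ^ 'm"
  shows "\<bar>M *v x\<bar> \<le> \<bar>M\<bar> *v \<bar>x\<bar>"
  by (auto simp: less_eq_vec_def abs_vec_def matrix_vector_mult_def abs_mult
      intro: order_trans[OF sum_abs])

lemma abs_sup_zero_diff_le: "\<bar>sup 0 x - sup 0 y\<bar> \<le> \<bar>x - (y :: real ^ 'n)\<bar>"
  by (auto simp: less_eq_vec_def abs_vec_entry sup_zero_vec_entry)

text \<open>Substituting \<open>\<bar>x\<bar> = 2 *\<^sub>R sup 0 x - x\<close> into the equation
  and adding \<open>\<Omega> *v x\<close> on both sides gives a linear system with matrix
  \<open>A + B + \<Omega>\<close>, which is then inverted.\<close>

lemma gave_solution_fixed_point: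
  fixes A B \<Omega> :: "real ^ 'n ^ 'n"
  assumes "gave_solution A B b x" and "invertible (A + B + \<Omega>)"
  shows "x = matrix_inv (A + B + \<Omega>) *v (\<Omega> *v x + 2 *\<^sub>R (B *v sup 0 x) + b)"
proof -
  have "\<bar>x\<bar> = 2 *\<^sub>R sup 0 x - x"
    by (auto simp: vec_eq_iff abs_vec_entry sup_zero_vec_entry)
  then have "\<Omega> *v x + 2 *\<^sub>R (B *v sup 0 x) + b = (A + B + \<Omega>) *v x"
    using assms(1)
    by (auto simp: gave_solution_def matrix_vector_mult_add_rdistrib matrix_vector_mult_diff_distrib
        matrix_vector_mult_scaleR)
  \<comment> \<open>\<open>matrix_inv\<close> is a choice, which is a genuine inverse because one
    exists.\<close>
  moreover have "matrix_inv (A + B + \<Omega>) ** (A + B + \<Omega>) = mat 1"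
    using assms(2) unfolding invertible_def matrix_inv_def by (metis (mono_tags, lifting) someI_ex)
  ultimately show ?thesis
    by (simp add: matrix_vector_mul_assoc)
qed

theorem theorem2p1:
  fixes A B \<Omega> :: "real ^ 'n ^ 'n" and b xstar :: "real ^ 'n"
  assumes "gave_solution A B b xstar"
    and "\<And>y. gave_solution A B b y \<Longrightarrow> y = xstar"
    and "invertible (A + B + \<Omega>)"
    and "mat_spectral_radius (f_mat A B \<Omega> + g_mat A B \<Omega>) < 1"
  shows "\<forall>x0. max_iter A B \<Omega> b x0 \<longlonglongrightarrow> xstar"
proof
  fix x0
  let ?N = "matrix_inv (A + B + \<Omega>)"
  let ?x = "max_iter A B \<Omega> b x0"
  define T where "T = f_mat A B \<Omega> + g_mat A B \<Omega>"
  have "(\<lambda>k. ?x k - xstar) \<longlonglongrightarrow> 0"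
  proof (rule tendsto_zero_if_abs_le_nonneg_matrix)
    show "0 \<le> T"
      by (simp add: T_def f_mat_def g_mat_def scaleR_nonneg_nonneg)
    show "mat_spectral_radius T < 1"
      using assms(4) by (simp add: T_def)
    fix k
    let ?d = "?x k - xstar" and ?s = "sup 0 (?x k) - sup 0 xstar"
    \<comment> \<open>Rewriting \<open>xstar\<close> as its own image under the iteration lets
      \<open>b\<close> cancel.\<close>
    have "?x (Suc k) - xstar = ?N *v (\<Omega> *v ?x k + 2 *\<^sub>R (B *v sup 0 (?x k)) + b)
        - ?N *v (\<Omega> *v xstar + 2 *\<^sub>R (B *v sup 0 xstar) + b)"
      using gave_solution_fixed_point[OF assms(1,3)] by simp
    also have "\<dots> = (?N ** \<Omega>) *v ?d + 2 *\<^sub>R ((?N ** B) *v ?s)"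
      by (simp add: matrix_vector_right_distrib matrix_vector_mult_diff_distrib
          matrix_vector_mult_scaleR scaleR_diff_right flip: matrix_vector_mul_assoc)
    finally have "\<bar>?x (Suc k) - xstar\<bar> \<le> \<bar>(?N ** \<Omega>) *v ?d\<bar> + \<bar>2 *\<^sub>R ((?N ** B) *v ?s)\<bar>"
      using abs_triangle_ineq by metis
    also have "\<bar>2 *\<^sub>R ((?N ** B) *v ?s)\<bar> = 2 *\<^sub>R \<bar>(?N ** B) *v ?s\<bar>"
      by (simp add: vec_eq_iff abs_vec_entry abs_mult)
    \<comment> \<open>Nonexpansiveness replaces \<open>?s\<close> by \<open>?d\<close>, so that both
      terms act on the same vector and their matrices add up to \<open>T\<close>.\<close>
    also have "\<dots> \<le> 2 *\<^sub>R (\<bar>?N ** B\<bar> *v \<bar>?d\<bar>)"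
      by (intro scaleR_left_mono order_trans[OF abs_matrix_vector_le]
          nonneg_matrix_vector_mono abs_sup_zero_diff_le) auto
    also have "\<bar>(?N ** \<Omega>) *v ?d\<bar> \<le> \<bar>?N ** \<Omega>\<bar> *v \<bar>?d\<bar>"
      by (rule abs_matrix_vector_le)
    finally show "\<bar>?x (Suc k) - xstar\<bar> \<le> T *v \<bar>?d\<bar>"
      by (simp add: T_def f_mat_def g_mat_def matrix_vector_mult_add_rdistrib
          scaleR_matrix_vector_assoc add_left_mono add_right_mono)
  qed
  then show "?x \<longlonglongrightarrow> xstar"
    by (simp add: LIM_zero_iff)
qed

end
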